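(* For every positive integer $k$ there exists $n_0=n_0(k)$ such that the following holds for all integers $n\ge n_0$. Let $t\ge 2$ and $k_1,\ldots,k_t$ be positive integers with $\max\{k_i : i\in[t]\}=k$, with $k_1\ge k_i$ and $k_2\ge k_i$ for all $i\in\{3,\ldots,t\}$, and with $$\sum_{i=1}^t k_i\le n\left(1-\left(\frac{8k\ln n}{n}\right)^{1/k}\right).$$ Let $\mathcal{F}_i\subseteq\binom{[n]}{k_i}$ for $i\in[t]$ be such that $$|\mathcal{F}_1|\,|\mathcal{F}_2|>\binom{n-1}{k_1-1}\binom{n-1}{k_2-1}\quad\text{when } t=2,$$ and $$\prod_{i=1}^t|\mathcal{F}_i|>\binom{n-1}{k_1-1}\binom{n-1}{k_2-1}\prod_{i=3}^t\binom{n}{k_i}\quad\text{when } t\ge 3.$$ Then $\{\mathcal{F}_1,\ldots,\mathcal{F}_t\}$ admits a rainbow matching.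
   Context: For a positive integer $m$, $[m]:=\{1,\ldots,m\}$, and for a set $S$, $\binom{S}{m}:=\{T\subseteq S: |T|=m\}$. A rainbow matching for families of sets $\mathcal{F}_1,\ldots,\mathcal{F}_t$ is a choice of sets $e_i\in\mathcal{F}_i$, one for each $i\in[t]$, that are pairwise disjoint. The family $\{\mathcal{F}_1,\ldots,\mathcal{F}_t\}$ admits a rainbow matching if one exists; it is understood as an indexed family. *)

theory Defs
  imports Complex_Main "HOL-Library.Disjoint_Sets" "HOL-Library.Ramsey"
begin

text \<open>
  The families are indexed by \<open>{1..t}\<close>, so the same family may occur at several indices.
  Disjointness is required for distinct indices (not just for distinct sets).
\<close>

definition rainbow_matching :: "nat \<Rightarrow> (nat \<Rightarrow> 'a set set) \<Rightarrow> (nat \<Rightarrow> 'a set) \<Rightarrow> bool" where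
  "rainbow_matching t F e \<longleftrightarrow> (\<forall>i\<in>{1..t}. e i \<in> F i) \<and> disjoint_family_on e {1..t}"

definition admits_rainbow_matching :: "nat \<Rightarrow> (nat \<Rightarrow> 'a set set) \<Rightarrow> bool" where
  "admits_rainbow_matching t F \<longleftrightarrow> (\<exists>e. rainbow_matching t F e)"

end

theory Submission
  imports Defs "HOL-Real_Asymp.Real_Asymp"
begin

text \<open>
  Write \<open>p i\<close> for the density of \<open>F i\<close> among the \<open>ks i\<close>-subsets of \<open>{1..n}\<close>. Because
  \<open>n * ((n - 1) choose (m - 1)) = m * (n choose m)\<close>, the hypothesis says that the product of all
  densities exceeds \<open>ks 1 * ks 2 / n\<^sup>2\<close>. Densities are at most \<open>1\<close>, so the same lower bound holds for the
  product over every set \<open>J\<close> of indices.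

  The matching is built greedily. Call a family blocked, relative to \<open>J\<close>, if some set of at most
  \<open>sum ks J\<close> points meets all its members. If every \<open>J\<close> has a matching or contains an index
  whose family is not blocked, then such an index can be treated last and induction over \<open>J\<close> gives a
  matching of everything (\<open>greedy_matching\<close>). So a set \<open>J\<close> of blocked families without a matching has
  to be excluded.

  If \<open>J\<close> has at least three elements, blocked families are so sparse that the product of their
  densities is at most \<open>1 / n\<^sup>2\<close>, a contradiction (\<open>blocked_product_le\<close>). Only here the bound on the
  sum of the sizes is used: the points that remain make a blocked family miss a proportion of at
  least about \<open>8 k ln n / n\<close> of all sets.

  If \<open>J\<close> is a pair without a matching, its two families are cross-intersecting. For large \<open>n\<close> the
  product of their cardinalities is at most that of two stars (\<open>cross_intersecting_card_le\<close>), hence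
  the product of their densities is at most \<open>ks a * ks b / n\<^sup>2 \<le> ks 1 * ks 2 / n\<^sup>2\<close>, again a
  contradiction. This is where the exact constant of the hypothesis is needed.
\<close>

section \<open>Families of sets that meet given sets\<close>

lemma card_supersets_le:
  assumes "finite A" "finite T" "card T \<le> m"
  shows "card {B \<in> nsets A m. T \<subseteq> B} \<le> (card A - card T) choose (m - card T)"
proof (cases "T \<subseteq> A")
  case True
  have "inj_on (\<lambda>B. B - T) {B \<in> nsets A m. T \<subseteq> B}"
    by (auto simp: inj_on_def)
  moreover have "(\<lambda>B. B - T) ` {B \<in> nsets A m. T \<subseteq> B} \<subseteq> nsets (A - T) (m - card T)"
    using assms(2) by (auto simp: nsets_def card_Diff_subset)
  ultimately have "card {B \<in> nsets A m. T \<subseteq> B} \<le> card (nsets (A - T) (m - card T))"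
    using assms(1) by (meson card_inj_on_le finite_Diff finite_imp_finite_nsets)
  then show ?thesis
    using True assms by (simp add: card_Diff_subset)
next
  case False
  then have "{B \<in> nsets A m. T \<subseteq> B} = {}"
    by (auto simp: nsets_def)
  then show ?thesis by (metis card.empty zero_le)
qed

lemma card_star_le:
  assumes "finite A" "m > 0"
  shows "card {B \<in> nsets A m. x \<in> B} \<le> (card A - 1) choose (m - 1)"
  using card_supersets_le[of A "{x}" m] assms by simp

text \<open>
  The bound is multiplied out by \<open>card A - 1\<close>: this compares a pair star with a full star, and it
  stays true for \<open>m = 1\<close>, where no member contains two points but the truncated
  \<open>(card A - 2) choose (m - 2)\<close> would be \<open>1\<close>.
\<close>
lemma card_pair_star_le:
  assumes "finite A" "m > 0" "x \<noteq> y"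
  shows "(card A - 1) * card {B \<in> nsets A m. x \<in> B \<and> y \<in> B} \<le> (m - 1) * ((card A - 1) choose (m - 1))"
proof (cases "m = 1")
  case True
  have "{B \<in> nsets A m. x \<in> B \<and> y \<in> B} = {}"
    using assms(3) True by (auto simp: nsets_def card_1_singleton_iff)
  then show ?thesis by (metis card.empty mult_0_right zero_le)
next
  case False
  then have "card {B \<in> nsets A m. x \<in> B \<and> y \<in> B} \<le> (card A - 2) choose (m - 2)"
    using card_supersets_le[of A "{x, y}" m] assms by (simp add: numeral_2_eq_2)
  then have "(card A - 1) * card {B \<in> nsets A m. x \<in> B \<and> y \<in> B}
      \<le> (card A - 1) * ((card A - 2) choose (m - 2))"
    by simp
  also have "\<dots> = (m - 1) * ((card A - 1) choose (m - 1))"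
    using times_binomial_minus1_eq[of "m - 1" "card A - 1"] False assms
    by (simp add: numeral_2_eq_2)
  finally show ?thesis .
qed

lemma card_meeting_le:
  assumes "finite A" "m > 0" "F \<subseteq> nsets A m" "finite U" "\<And>e. e \<in> F \<Longrightarrow> e \<inter> U \<noteq> {}"
  shows "card F \<le> card U * ((card A - 1) choose (m - 1))"
proof -
  have "F \<subseteq> (\<Union>x\<in>U. {B \<in> nsets A m. x \<in> B})"
    using assms(3,5) by blast
  then have "card F \<le> card (\<Union>x\<in>U. {B \<in> nsets A m. x \<in> B})"
    using assms(1,4) by (intro card_mono) (auto simp: finite_imp_finite_nsets)
  also have "\<dots> \<le> (\<Sum>x\<in>U. card {B \<in> nsets A m. x \<in> B})"
    by (rule card_UN_le[OF assms(4)])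
  also have "\<dots> \<le> (\<Sum>x\<in>U. (card A - 1) choose (m - 1))"
    by (intro sum_mono card_star_le assms)
  finally show ?thesis by simp
qed

text \<open>
  The members of \<open>F\<close> all differ from the \<open>m\<close>-sets that avoid \<open>U\<close>. This is the sharp bound for large
  \<open>U\<close>, where the union bound of the previous lemma is void.
\<close>
lemma card_meeting_complement:
  assumes "finite A" "F \<subseteq> nsets A m" "finite U" "\<And>e. e \<in> F \<Longrightarrow> e \<inter> U \<noteq> {}"
  shows "card F + ((card A - card U) choose m) \<le> card A choose m"
proof -
  have fin: "finite (nsets A m)" "finite (nsets (A - U) m)"
    using assms(1) by (auto simp: finite_imp_finite_nsets)
  have "(card A - card U) choose m \<le> card (nsets (A - U) m)"
    using assms(1) diff_card_le_card_Diff[OF assms(3), of A] by (simp add: binomial_right_mono)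
  moreover have "card F + card (nsets (A - U) m) = card (F \<union> nsets (A - U) m)"
    using fin assms(2,4)
    by (intro card_Un_disjoint[symmetric]) (auto simp: nsets_def dest: finite_subset)
  moreover have "card (F \<union> nsets (A - U) m) \<le> card (nsets A m)"
    using fin assms(2) nsets_mono[of "A - U" A m] by (intro card_mono) auto
  ultimately show ?thesis by simp
qed

text \<open>
  Every member of \<open>G\<close> meets \<open>S\<close> in some \<open>x\<close> and then meets the set that avoids \<open>x\<close> in another point
  \<open>y\<close>, so \<open>G\<close> is covered by boundedly many pair stars. It is thus smaller than a star by a factor of
  order \<open>card A\<close>.
\<close>
lemma card_doubly_meeting_le:
  assumes "finite A" "m > 0" "G \<subseteq> nsets A m" "finite S"
    and S: "\<And>B. B \<in> G \<Longrightarrow> B \<inter> S \<noteq> {}"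
    and avoid: "\<And>x. x \<in> S \<Longrightarrow> \<exists>T. finite T \<and> card T \<le> l \<and> x \<notin> T \<and> (\<forall>B\<in>G. B \<inter> T \<noteq> {})"
  shows "(card A - 1) * card G \<le> card S * l * (m - 1) * ((card A - 1) choose (m - 1))"
proof -
  let ?c = "(m - 1) * ((card A - 1) choose (m - 1))"
  let ?P = "\<lambda>x y. {B \<in> nsets A m. x \<in> B \<and> y \<in> B}"
  obtain T where T: "\<And>x. x \<in> S \<Longrightarrow> finite (T x) \<and> card (T x) \<le> l \<and> x \<notin> T x \<and> (\<forall>B\<in>G. B \<inter> T x \<noteq> {})"
    using avoid by metis
  have finP: "finite (?P x y)" for x y
    using assms(1) by (simp add: finite_imp_finite_nsets)
  have "G \<subseteq> (\<Union>x\<in>S. \<Union>y\<in>T x. ?P x y)"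
  proof
    fix B assume B: "B \<in> G"
    then obtain x where x: "x \<in> S" "x \<in> B" using S by blast
    moreover obtain y where "y \<in> T x" "y \<in> B" using T[OF x(1)] B by blast
    ultimately show "B \<in> (\<Union>x\<in>S. \<Union>y\<in>T x. ?P x y)" using B assms(3) by blast
  qed
  then have "card G \<le> card (\<Union>x\<in>S. \<Union>y\<in>T x. ?P x y)"
    using assms(4) T finP by (intro card_mono finite_UN_I) auto
  also have "\<dots> \<le> (\<Sum>x\<in>S. card (\<Union>y\<in>T x. ?P x y))"
    by (rule card_UN_le[OF assms(4)])
  also have "\<dots> \<le> (\<Sum>x\<in>S. \<Sum>y\<in>T x. card (?P x y))"
    using T by (intro sum_mono card_UN_le) auto
  finally have "(card A - 1) * card G \<le> (card A - 1) * (\<Sum>x\<in>S. \<Sum>y\<in>T x. card (?P x y))"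
    by simp
  also have "\<dots> = (\<Sum>x\<in>S. \<Sum>y\<in>T x. (card A - 1) * card (?P x y))"
    by (simp add: sum_distrib_left)
  also have "\<dots> \<le> (\<Sum>x\<in>S. \<Sum>y\<in>T x. ?c)"
    using T by (intro sum_mono card_pair_star_le assms) auto
  also have "\<dots> \<le> (\<Sum>x\<in>S. l * ?c)"
    using T by (intro sum_mono) (simp add: mult_le_mono1)
  finally show ?thesis by (simp add: mult.assoc)
qed

section \<open>Cross-intersecting families\<close>

text \<open>
  If all members of both families share a point, the bound is the product of two star sizes.
  Otherwise one of the families is doubly met: either \<open>F\<close> has a common point \<open>x\<close> and some member of
  \<open>G\<close> avoids it, or \<open>F\<close> has no common point and the members of \<open>F\<close> themselves serve as avoiding
  sets for \<open>G\<close>. That family loses a factor of order \<open>card A\<close> against a star, while the other one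
  exceeds a star by a factor of at most \<open>k\<close>. The condition \<open>k ^ 4 < card A\<close> makes the loss win.
\<close>
theorem cross_intersecting_card_le:
  assumes A: "finite A" "k ^ 4 < card A"
    and a: "0 < a" "a \<le> k" and b: "0 < b" "b \<le> k"
    and F: "F \<subseteq> nsets A a" and G: "G \<subseteq> nsets A b"
    and cross: "\<And>X Y. X \<in> F \<Longrightarrow> Y \<in> G \<Longrightarrow> X \<inter> Y \<noteq> {}"
  shows "card F * card G \<le> ((card A - 1) choose (a - 1)) * ((card A - 1) choose (b - 1))"
proof (cases "F = {} \<or> G = {}")
  case True
  then show ?thesis by auto
next
  case False
  then obtain X0 Y0 where X0: "X0 \<in> F" and Y0: "Y0 \<in> G" by blast
  let ?ca = "(card A - 1) choose (a - 1)" and ?cb = "(card A - 1) choose (b - 1)"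
  have FD: "finite X" "card X = a" if "X \<in> F" for X using that F by (auto simp: nsets_def)
  have GD: "finite Y" "card Y = b" if "Y \<in> G" for Y using that G by (auto simp: nsets_def)
  have F_le: "card F \<le> k * ?ca"
    using card_meeting_le[OF A(1) a(1) F, of Y0] cross[OF _ Y0] GD[OF Y0] b
    by (meson le_trans mult_le_mono1 order_eq_refl)
  have G_le: "card G \<le> k * ?cb"
    using card_meeting_le[OF A(1) b(1) G, of X0] cross[OF X0] FD[OF X0] a
    by (metis (no_types, lifting) Int_commute le_trans mult_le_mono1)
  have final: ?thesis if "(card A - 1) * (card F * card G) \<le> k ^ 4 * (?ca * ?cb)"
  proof -
    \<comment> \<open>As \<open>k ^ 4\<close> is at most \<open>card A - 1\<close>, the two factors cancel and leave the exact bound.\<close>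
    have "0 < k ^ 4" using a by simp
    then have "k ^ 4 \<le> card A - 1" "card A - 1 > 0" using A(2) by linarith+
    moreover from this have "(card A - 1) * (card F * card G) \<le> (card A - 1) * (?ca * ?cb)"
      using that by (meson le_trans mult_le_mono1)
    ultimately show ?thesis by simp
  qed
  show ?thesis
  proof (cases "\<exists>x. \<forall>X\<in>F. x \<in> X")
    case True
    then obtain x where x: "\<And>X. X \<in> F \<Longrightarrow> x \<in> X" by blast
    show ?thesis
    proof (cases "\<forall>Y\<in>G. x \<in> Y")
      case True
      have "card F \<le> card {X \<in> nsets A a. x \<in> X}"
        using F x A(1) by (intro card_mono) (auto simp: finite_imp_finite_nsets)
      moreover have "card G \<le> card {Y \<in> nsets A b. x \<in> Y}"
        using G True A(1) by (intro card_mono) (auto simp: finite_imp_finite_nsets)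
      ultimately show ?thesis
        using card_star_le[OF A(1) a(1), of x] card_star_le[OF A(1) b(1), of x]
        by (intro mult_le_mono) linarith+
    next
      case False
      then obtain Y where Y: "Y \<in> G" "x \<notin> Y" by blast
      have "(card A - 1) * card F \<le> card {x} * k * (a - 1) * ?ca"
        using x Y GD b cross
        by (intro card_doubly_meeting_le A a F) (auto intro!: exI[of _ Y])
      also have "\<dots> \<le> k * k * ?ca"
        using a by (intro mult_le_mono) auto
      finally have "((card A - 1) * card F) * card G \<le> (k * k * ?ca) * (k * ?cb)"
        using G_le by (rule mult_le_mono)
      also have "\<dots> = k ^ 3 * (?ca * ?cb)"
        by (simp add: power3_eq_cube)
      also have "\<dots> \<le> k ^ 4 * (?ca * ?cb)"
        using a by (intro mult_le_mono1 power_increasing) auto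
      finally show ?thesis by (intro final) (simp add: mult.assoc)
    qed
  next
    case False
    have "(card A - 1) * card G \<le> card X0 * k * (b - 1) * ?cb"
    proof (rule card_doubly_meeting_le[OF A(1) b(1) G])
      show "finite X0" using FD X0 by simp
      show "B \<inter> X0 \<noteq> {}" if "B \<in> G" for B using cross[OF X0 that] by blast
      fix x
      obtain X where X: "X \<in> F" "x \<notin> X" using False by blast
      then have "\<forall>B\<in>G. B \<inter> X \<noteq> {}" using cross[of X] by blast
      then show "\<exists>T. finite T \<and> card T \<le> k \<and> x \<notin> T \<and> (\<forall>B\<in>G. B \<inter> T \<noteq> {})"
        using FD[OF X(1)] a X by (intro exI[of _ X]) auto
    qed
    also have "\<dots> \<le> k * k * k * ?cb"
      using FD[OF X0] a b by (intro mult_le_mono) auto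
    finally have "card F * ((card A - 1) * card G) \<le> (k * ?ca) * (k * k * k * ?cb)"
      by (rule mult_le_mono[OF F_le])
    then show ?thesis
      by (intro final) (simp add: eval_nat_numeral ac_simps)
  qed
qed

section \<open>Greedy matchings\<close>

text \<open>
  A rainbow matching of the families indexed by an arbitrary set, as the greedy argument passes
  through subfamilies whose index set is not an interval.
\<close>
definition matched :: "'i set \<Rightarrow> ('i \<Rightarrow> 'a set set) \<Rightarrow> bool" where
  "matched J F \<longleftrightarrow> (\<exists>e. (\<forall>i\<in>J. e i \<in> F i) \<and> disjoint_family_on e J)"

text \<open>
  Induction on \<open>J\<close>: a family \<open>i\<close> that cannot be blocked by \<open>sum ks J\<close> points is left for last, since
  a matching of \<open>J - {i}\<close> uses at most that many points. Choosing the last family in this way for every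
  \<open>J\<close> makes it unnecessary to sort the families by density.
\<close>
lemma greedy_matching:
  assumes "finite I"
    and sizes: "\<And>i e. i \<in> I \<Longrightarrow> e \<in> F i \<Longrightarrow> finite e \<and> card e \<le> ks i"
    and step: "\<And>J. J \<subseteq> I \<Longrightarrow> matched J F \<or>
      (\<exists>i\<in>J. \<forall>U. finite U \<longrightarrow> card U \<le> sum ks J \<longrightarrow> (\<exists>e\<in>F i. e \<inter> U = {}))"
  shows "matched I F"
proof -
  have "J \<subseteq> I \<Longrightarrow> matched J F" if "finite J" for J
    using that
  proof (induction J rule: finite_psubset_induct)
    case (psubset J)
    from step[OF psubset.prems] show ?case
    proof (elim disjE bexE)
      fix i assume i: "i \<in> J"
        and free: "\<forall>U. finite U \<longrightarrow> card U \<le> sum ks J \<longrightarrow> (\<exists>e\<in>F i. e \<inter> U = {})"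
      have "matched (J - {i}) F"
        using i psubset.prems by (intro psubset.IH) auto
      then obtain e where e: "\<And>j. j \<in> J - {i} \<Longrightarrow> e j \<in> F j" "disjoint_family_on e (J - {i})"
        unfolding matched_def by blast
      let ?U = "\<Union>j\<in>J - {i}. e j"
      have fin: "finite ?U"
        using psubset.hyps psubset.prems e sizes by blast
      have "card ?U \<le> (\<Sum>j\<in>J - {i}. card (e j))"
        using psubset.hyps by (intro card_UN_le) auto
      also have "\<dots> \<le> sum ks (J - {i})"
        using psubset.prems e sizes by (intro sum_mono) blast
      also have "\<dots> \<le> sum ks J"
        using psubset.hyps by (intro sum_mono2) auto
      finally obtain e' where e': "e' \<in> F i" "e' \<inter> ?U = {}"
        using fin free by blast
      have "\<forall>j\<in>J. (e(i := e')) j \<in> F j"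
        using e e' by auto
      moreover have "disjoint_family_on (e(i := e')) J"
        using e(2) e'(2) unfolding disjoint_family_on_def by (auto 0 3)
      ultimately show ?thesis
        unfolding matched_def by blast
    qed
  qed
  then show ?thesis using assms(1) by blast
qed

lemma matchedI_pair:
  assumes "X \<in> F a" "Y \<in> F b" "X \<inter> Y = {}" "a \<noteq> b"
  shows "matched {a, b} F"
  unfolding matched_def
  by (rule exI[of _ "\<lambda>i. if i = a then X else Y"]) (use assms in \<open>auto simp: disjoint_family_on_def\<close>)

section \<open>Densities of blocked families\<close>

text \<open>
  Each of the \<open>m\<close> factors of the ratio, \<open>(n - s - i) / (n - i)\<close>, is at least \<open>(n - s - m) / n\<close>.
\<close>
lemma binomial_ratio_ge:
  assumes "s + m \<le> n"
  shows "((real n - real s - real m) / real n) ^ m * real (n choose m) \<le> real ((n - s) choose m)"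
proof -
  let ?r = "(real n - real s - real m) / real n"
  have "?r ^ m * real (n choose m) = (\<Prod>i = 0..<m. ?r * (real (n - i) / real (m - i)))"
    unfolding prod.distrib using assms by (simp add: binomial_altdef_of_nat)
  also have "\<dots> \<le> (\<Prod>i = 0..<m. real (n - s - i) / real (m - i))"
  proof (rule prod_mono)
    fix i assume i: "i \<in> {0..<m}"
    have r0: "?r \<ge> 0" using assms by simp
    have "?r * real (n - i) \<le> ?r * real n"
      using r0 by (intro mult_left_mono) auto
    also have "\<dots> = real n - real s - real m"
      using i assms by simp
    also have "\<dots> \<le> real (n - s - i)"
      using i assms by (simp add: of_nat_diff)
    finally have "?r * real (n - i) / real (m - i) \<le> real (n - s - i) / real (m - i)"
      by (intro divide_right_mono) auto
    then show "0 \<le> ?r * (real (n - i) / real (m - i)) \<and>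
        ?r * (real (n - i) / real (m - i)) \<le> real (n - s - i) / real (m - i)"
      using mult_nonneg_nonneg[OF r0, of "real (n - i) / real (m - i)"] by simp
  qed
  also have "\<dots> = real ((n - s) choose m)"
    using assms by (simp add: binomial_altdef_of_nat)
  finally show ?thesis .
qed

text \<open>
  A random \<open>m\<close>-set avoids \<open>s\<close> points with probability close to \<open>(1 - s / n) ^ m \<ge> d ^ k\<close>. The factor
  \<open>1 / 2\<close> absorbs the error made by drawing without replacement; by Bernoulli's inequality it
  suffices for this that at least \<open>2 k\<^sup>2\<close> points remain.
\<close>
lemma blocked_card_le:
  assumes m: "m \<le> k" and F: "F \<subseteq> nsets {1..n} m" and n: "n > 0"
    and U: "finite U" "card U \<le> s" "\<And>e. e \<in> F \<Longrightarrow> e \<inter> U \<noteq> {}"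
    and d: "2 * real k ^ 2 \<le> d * real n" "real s \<le> real n * (1 - d)" "0 < d" "d \<le> 1"
  shows "real (card F) \<le> (1 - d ^ k / 2) * real (n choose m)"
proof -
  have kd: "real k \<le> d * real n"
    using d(1) by (cases "k = 0") (auto simp: power2_eq_square intro: order_trans[rotated])
  have "real s + real m \<le> real n"
    using kd d(2) m by (simp add: right_diff_distrib mult.commute)
  then have sm: "s + m \<le> n"
    by (simp flip: of_nat_add)
  have "d ^ k * (1 / 2) \<le> d ^ m * (1 / 2)"
    using d m by (intro mult_right_mono power_decreasing) auto
  also have "d ^ m * (1 / 2) \<le> d ^ m * (1 - real m / (d * real n)) ^ m"
  proof (intro mult_left_mono)
    have "real m * (real m / (d * real n)) \<le> 1 / 2"
    proof -
      have "real m ^ 2 \<le> real k ^ 2" using m by (intro power_mono) auto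
      then show ?thesis using d n by (simp add: field_simps power2_eq_square)
    qed
    moreover have "1 + real m * (- (real m / (d * real n))) \<le> (1 + (- (real m / (d * real n)))) ^ m"
      using kd m d n by (intro Bernoulli_inequality) (simp add: field_simps)
    ultimately show "1 / 2 \<le> (1 - real m / (d * real n)) ^ m" by simp
  qed (use d in auto)
  also have "\<dots> = (d - real m / real n) ^ m"
    using d n by (simp add: field_simps flip: power_mult_distrib)
  also have "\<dots> \<le> ((real n - real s - real m) / real n) ^ m"
  proof (rule power_mono)
    show "d - real m / real n \<le> (real n - real s - real m) / real n"
      using n d(2) by (simp add: le_divide_eq left_diff_distrib right_diff_distrib mult.commute)
    show "0 \<le> d - real m / real n"
      using n kd m by (simp add: divide_le_eq)
  qed
  finally have "d ^ k / 2 * real (n choose m) \<le>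
      ((real n - real s - real m) / real n) ^ m * real (n choose m)"
    by (intro mult_right_mono) auto
  also have "\<dots> \<le> real ((n - s) choose m)"
    using sm by (rule binomial_ratio_ge)
  also have "\<dots> \<le> real ((n - card U) choose m)"
    using U(2) by (simp add: binomial_right_mono)
  finally have "d ^ k / 2 * real (n choose m) \<le> real ((n - card U) choose m)" .
  moreover have "card F + ((n - card U) choose m) \<le> n choose m"
    using card_meeting_complement[of "{1..n}" F m U] F U by simp
  then have "real (card F) + real ((n - card U) choose m) \<le> real (n choose m)"
    by (simp flip: of_nat_add)
  ultimately show ?thesis by (simp add: algebra_simps)
qed

text \<open>
  The estimate behind the greedy step. Let \<open>j = card J\<close> and \<open>s = sum ks J \<le> k j\<close>. Three ranges are
  distinguished by the reason for which a blocked family is sparse.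

  For small \<open>j\<close> the union bound gives density at most \<open>x = k\<^sup>2 j / n\<close>. As \<open>j \<ge> 3\<close>, the product is at
  most \<open>x ^ 3\<close>, which is below \<open>1 / n\<^sup>2\<close> as long as \<open>k ^ 6 * j ^ 3 \<le> n\<close>. (Two families with density
  of order \<open>1 / n\<close> cannot be excluded in this way; they need the cross-intersection theorem.)

  For larger \<open>j\<close> with \<open>s \<le> n / 2\<close> every density is at most \<open>1 - (1 / 2) ^ k / 2\<close>, and a power of
  this constant with exponent at least of order \<open>n powr (1 / 3)\<close> is far below \<open>1 / n\<^sup>2\<close>.

  For \<open>s > n / 2\<close> the assumption on the sum of the sizes leaves a fraction \<open>d\<close> of the points unused,
  where \<open>d ^ k = 8 k ln n / n\<close>. Each density is then at most \<open>1 - 4 k ln n / n\<close>, and there are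
  \<open>j \<ge> n / (2 k)\<close> of them, so that the product is at most \<open>exp (- 2 ln n)\<close>.
\<close>
lemma blocked_product_le:
  fixes ks :: "'i \<Rightarrow> nat"
  defines "p \<equiv> \<lambda>F n i. real (card (F i)) / real (n choose ks i)"
  assumes J: "finite J" "card J \<ge> 3" and ks: "\<And>i. i \<in> J \<Longrightarrow> 0 < ks i \<and> ks i \<le> k"
    and n: "k \<le> n" "real k \<le> ln (real n)" "8 * real k * ln (real n) \<le> real n"
      "2 * ln (real n) \<le> 1 / (2 ^ Suc k * real k ^ 2) * real n powr (1 / 3)"
      "4 * real k ^ 2 \<le> real n"
    and sum: "real (sum ks J) \<le> real n * (1 - (8 * real k * ln (real n) / real n) powr (1 / real k))"
    and F: "\<And>i. i \<in> J \<Longrightarrow> F i \<subseteq> nsets {1..n} (ks i)"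
    and blocked: "\<And>i. i \<in> J \<Longrightarrow> \<exists>U. finite U \<and> card U \<le> sum ks J \<and> (\<forall>e\<in>F i. e \<inter> U \<noteq> {})"
  shows "(\<Prod>i\<in>J. p F n i) \<le> 1 / real n ^ 2"
proof -
  define s where "s = sum ks J"
  define j where "j = card J"
  have k0: "k > 0" using J ks by (metis card.empty card_eq_0_iff equals0I le_trans less_le_trans not_numeral_le_zero)
  have n0: "n > 0" using n(1) k0 by simp
  have C0: "real (n choose ks i) > 0" if "i \<in> J" for i
    using ks[OF that] n(1) by simp
  have s_le: "s \<le> k * j"
    using sum_bounded_above[of J ks k] ks unfolding s_def j_def by (simp add: mult.commute)
  \<comment> \<open>The last two ranges differ only in the fraction \<open>d\<close> of points that remain.\<close>
  have dense: "(\<Prod>i\<in>J. p F n i) \<le> 1 / real n ^ 2"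
    if d: "2 * real k ^ 2 \<le> d * real n" "real s \<le> real n * (1 - d)" "0 < d" "d \<le> 1"
      and large: "2 * ln (real n) \<le> d ^ k / 2 * real j" for d
  proof -
    have "(\<Prod>i\<in>J. p F n i) \<le> (\<Prod>i\<in>J. exp (- (d ^ k / 2)))"
    proof (rule prod_mono)
      fix i assume i: "i \<in> J"
      obtain U where U: "finite U" "card U \<le> s" "\<And>e. e \<in> F i \<Longrightarrow> e \<inter> U \<noteq> {}"
        using blocked[OF i] unfolding s_def by blast
      have "real (card (F i)) \<le> (1 - d ^ k / 2) * real (n choose ks i)"
        using ks[OF i] by (intro blocked_card_le[OF _ F[OF i] n0 U d]) auto
      then have "p F n i \<le> 1 - d ^ k / 2"
        using C0[OF i] by (simp add: p_def divide_le_eq)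
      also have "\<dots> \<le> exp (- (d ^ k / 2))"
        using exp_ge_add_one_self[of "- (d ^ k / 2)"] by simp
      finally show "0 \<le> p F n i \<and> p F n i \<le> exp (- (d ^ k / 2))" by (simp add: p_def)
    qed
    also have "\<dots> = exp (- (d ^ k / 2 * real j))"
      by (simp add: j_def exp_of_nat_mult[symmetric] mult.commute)
    also have "\<dots> \<le> exp (- (2 * ln (real n)))"
      using large by simp
    also have "\<dots> = 1 / real n ^ 2"
      using n0 by (simp add: exp_minus exp_double field_simps)
    finally show ?thesis .
  qed
  consider "k ^ 6 * j ^ 3 \<le> n" | "n < k ^ 6 * j ^ 3" "2 * s \<le> n" | "n < 2 * s"
    by linarith
  then show ?thesis
  proof cases
    case 1
    define x where "x = real (k ^ 2 * j) / real n"
    have "(\<Prod>i\<in>J. p F n i) \<le> (\<Prod>i\<in>J. x)"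
    proof (rule prod_mono)
      fix i assume i: "i \<in> J"
      obtain U where U: "finite U" "card U \<le> s" "\<And>e. e \<in> F i \<Longrightarrow> e \<inter> U \<noteq> {}"
        using blocked[OF i] unfolding s_def by blast
      have "card (F i) \<le> card U * ((n - 1) choose (ks i - 1))"
        using card_meeting_le[OF _ _ F[OF i] U(1,3)] ks[OF i] by simp
      then have "n * card (F i) \<le> card U * (n * ((n - 1) choose (ks i - 1)))"
        by (metis mult.left_commute mult_le_mono2)
      also have "\<dots> = card U * (ks i * (n choose ks i))"
        using ks[OF i] by (simp add: times_binomial_minus1_eq)
      also have "\<dots> \<le> (k * j) * (k * (n choose ks i))"
        using U(2) s_le ks[OF i] by (intro mult_le_mono) auto
      finally have "real (n * card (F i)) \<le> real ((k * j) * (k * (n choose ks i)))"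
        by (rule of_nat_mono)
      then have "p F n i \<le> x"
        using C0[OF i] n0 by (simp add: p_def x_def field_simps power2_eq_square)
      then show "0 \<le> p F n i \<and> p F n i \<le> x" by (simp add: p_def)
    qed
    also have "\<dots> = x ^ j" by (simp add: j_def)
    also have "\<dots> \<le> x ^ 3"
    proof (rule power_decreasing)
      have "k ^ 2 * j \<le> k ^ 6 * j ^ 3"
        using k0 J(2) by (intro mult_le_mono power_increasing self_le_power) (auto simp: j_def)
      then show "x \<le> 1" using 1 n0 by (simp add: x_def divide_le_eq flip: of_nat_power of_nat_mult)
    qed (use J(2) in \<open>auto simp: j_def x_def\<close>)
    also have "\<dots> = real (k ^ 6 * j ^ 3) / real n ^ 3"
      by (simp add: x_def power_divide power_mult_distrib flip: power_mult)
    also have "\<dots> \<le> real n / real n ^ 3"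
      using 1 by (intro divide_right_mono) (auto simp flip: of_nat_power of_nat_mult)
    also have "\<dots> = 1 / real n ^ 2"
      using n0 by (simp add: power3_eq_cube power2_eq_square)
    finally show ?thesis .
  next
    case 2
    have "real n \<le> (real k ^ 2 * real j) ^ 3"
      using 2(1) by (simp add: power_mult_distrib flip: power_mult of_nat_power of_nat_mult)
    then have "real n powr (1 / 3) \<le> ((real k ^ 2 * real j) ^ 3) powr (1 / 3)"
      by (intro powr_mono2) auto
    also have "\<dots> = ((real k ^ 2 * real j) powr 3) powr (1 / 3)"
      using k0 J(2) by (subst powr_numeral) (auto simp: j_def)
    also have "\<dots> = real k ^ 2 * real j"
      by (subst powr_powr) simp
    finally have "1 / (2 ^ Suc k * real k ^ 2) * real n powr (1 / 3)
        \<le> 1 / (2 ^ Suc k * real k ^ 2) * (real k ^ 2 * real j)"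
      by (intro mult_left_mono) auto
    also have "\<dots> = (1 / 2) ^ k / 2 * real j"
      using k0 by (simp add: power_one_over field_simps)
    finally have "2 * ln (real n) \<le> (1 / 2) ^ k / 2 * real j"
      using n(4) by linarith
    moreover have "real s \<le> real n * (1 - 1 / 2)" using 2(2) by simp
    ultimately show ?thesis
      using n(5) by (intro dense[of "1 / 2"]) auto
  next
    case 3
    define y where "y = 8 * real k * ln (real n) / real n"
    define d where "d = y powr (1 / real k)"
    have ln0: "ln (real n) > 0" using n(2) k0 by simp
    have y: "0 < y" "y \<le> 1" using n n0 k0 ln0 by (auto simp: y_def)
    have d: "0 < d" "d \<le> 1" using y by (auto simp: d_def powr_le1)
    have dk: "d ^ k = y"
      using y k0 by (simp add: d_def powr_power)
    \<comment> \<open>Since \<open>d \<le> 1\<close>, \<open>d\<close> is at least \<open>d ^ k = y\<close>, so that enough points remain for Bernoulli.\<close>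
    have "y \<le> d"
      using d k0 dk power_decreasing[of 1 k d] by simp
    then have "8 * real k * ln (real n) \<le> d * real n"
      using n0 by (simp add: y_def field_simps)
    moreover have "real k * real k \<le> real k * ln (real n)"
      using n(2) by (intro mult_left_mono) auto
    moreover have "0 \<le> real k * ln (real n)" using ln0 by simp
    ultimately have "2 * real k ^ 2 \<le> d * real n"
      unfolding power2_eq_square by linarith
    moreover have "2 * ln (real n) \<le> d ^ k / 2 * real j"
    proof -
      have "n \<le> 2 * (k * j)" using 3 s_le by linarith
      then have "real n \<le> 2 * (real k * real j)" by (simp flip: of_nat_mult)
      then have "2 * ln (real n) * real n \<le> 2 * ln (real n) * (2 * (real k * real j))"
        using ln0 by (intro mult_left_mono) auto
      then show ?thesis
        using n0 unfolding dk y_def by (simp add: field_simps)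
    qed
    ultimately show ?thesis
      using sum d by (intro dense[of d]) (auto simp: d_def y_def s_def)
  qed
qed

lemma large_n:
  "\<forall>\<^sub>F n in sequentially. k ^ 4 < n \<and> k \<le> n \<and> real k \<le> ln (real n) \<and> 8 * real k * ln (real n) \<le> real n \<and>
      2 * ln (real n) \<le> 1 / (2 ^ Suc k * real k ^ 2) * real n powr (1 / 3) \<and> 4 * real k ^ 2 \<le> real n"
  if "k > 0" for k :: nat
proof -
  define c where "c = 1 / (2 ^ Suc k * real k ^ 2)"
  have "c > 0" using that by (simp add: c_def)
  then show ?thesis
    unfolding c_def[symmetric]
    by (intro eventually_conj eventually_gt_at_top eventually_ge_at_top; real_asymp)
qed

lemma prod_subset_ge:
  fixes p :: "'i \<Rightarrow> real"
  assumes "finite I" "J \<subseteq> I" "\<And>i. i \<in> I \<Longrightarrow> 0 \<le> p i \<and> p i \<le> 1"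
  shows "prod p I \<le> prod p J"
proof -
  have "prod p I = prod p (I - J) * prod p J"
    using assms by (intro prod.subset_diff)
  also have "\<dots> \<le> 1 * prod p J"
    using assms by (intro mult_right_mono prod_le_1 prod_nonneg) auto
  finally show ?thesis by simp
qed

section \<open>Rainbow matchings\<close>

theorem theorem1p4:
  fixes k :: nat
  assumes "k > 0"
  shows "\<exists>n0::nat. \<forall>n\<ge>n0. \<forall>(t::nat) (ks :: nat \<Rightarrow> nat) (F :: nat \<Rightarrow> nat set set).
    t \<ge> 2 \<longrightarrow>
    (\<forall>i\<in>{1..t}. ks i > 0) \<longrightarrow>
    Max (ks ` {1..t}) = k \<longrightarrow>
    (\<forall>i\<in>{3..t}. ks i \<le> ks 1 \<and> ks i \<le> ks 2) \<longrightarrow>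
    real (\<Sum>i=1..t. ks i) \<le> real n * (1 - (8 * real k * ln (real n) / real n) powr (1 / real k)) \<longrightarrow>
    (\<forall>i\<in>{1..t}. F i \<subseteq> nsets {1..n} (ks i)) \<longrightarrow>
    (t = 2 \<longrightarrow>
      card (F 1) * card (F 2) > ((n - 1) choose (ks 1 - 1)) * ((n - 1) choose (ks 2 - 1))) \<longrightarrow>
    (t \<ge> 3 \<longrightarrow>
      (\<Prod>i=1..t. card (F i)) >
        ((n - 1) choose (ks 1 - 1)) * ((n - 1) choose (ks 2 - 1)) * (\<Prod>i=3..t. n choose ks i)) \<longrightarrow>
    admits_rainbow_matching t F"
proof -
  obtain n0 where n0: "\<And>n. n \<ge> n0 \<Longrightarrow>
      k ^ 4 < n \<and> k \<le> n \<and> real k \<le> ln (real n) \<and> 8 * real k * ln (real n) \<le> real n \<and>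
      2 * ln (real n) \<le> 1 / (2 ^ Suc k * real k ^ 2) * real n powr (1 / 3) \<and> 4 * real k ^ 2 \<le> real n"
    using large_n[OF assms] unfolding eventually_sequentially by blast
  show ?thesis
  proof (rule exI[of _ n0], intro allI impI)
    fix n t :: nat and ks :: "nat \<Rightarrow> nat" and F :: "nat \<Rightarrow> nat set set"
    assume n: "n \<ge> n0" and t: "t \<ge> 2" and ks0: "\<forall>i\<in>{1..t}. ks i > 0"
      and Max: "Max (ks ` {1..t}) = k"
      and top: "\<forall>i\<in>{3..t}. ks i \<le> ks 1 \<and> ks i \<le> ks 2"
      and sum: "real (\<Sum>i=1..t. ks i) \<le> real n * (1 - (8 * real k * ln (real n) / real n) powr (1 / real k))"
      and F: "\<forall>i\<in>{1..t}. F i \<subseteq> nsets {1..n} (ks i)"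
      and two: "t = 2 \<longrightarrow>
        card (F 1) * card (F 2) > ((n - 1) choose (ks 1 - 1)) * ((n - 1) choose (ks 2 - 1))"
      and more: "t \<ge> 3 \<longrightarrow> (\<Prod>i=1..t. card (F i)) >
        ((n - 1) choose (ks 1 - 1)) * ((n - 1) choose (ks 2 - 1)) * (\<Prod>i=3..t. n choose ks i)"
    note n' = n0[OF n]
    have npos: "n > 0" using n' assms by linarith
    have ksk: "ks i \<le> k" if "i \<in> {1..t}" for i
      using Max that by (metis Max_ge finite_atLeastAtMost finite_imageI imageI)
    define p where "p i = real (card (F i)) / real (n choose ks i)" for i
    have C0: "0 < n choose ks i" if "i \<in> {1..t}" for i
      using ksk[OF that] n' by simp
    have absorb: "n * ((n - 1) choose (ks i - 1)) = ks i * (n choose ks i)" if "i \<in> {1..t}" for i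
      using ks0 that by (simp add: times_binomial_minus1_eq)
    have p01: "0 \<le> p i \<and> p i \<le> 1" if "i \<in> {1..t}" for i
    proof -
      have "card (F i) \<le> card (nsets {1..n} (ks i))"
        using F that by (intro card_mono) (auto simp: finite_imp_finite_nsets)
      then show ?thesis using C0[OF that] by (simp add: p_def divide_le_eq)
    qed

    \<comment> \<open>The cases \<open>t = 2\<close> and \<open>t \<ge> 3\<close> merge, the product over \<open>{3..t}\<close> being empty for \<open>t = 2\<close>.\<close>
    have I: "{1..t} = insert 1 (insert 2 {3..t})" using t by auto
    have split: "(\<Prod>i=1..t. f i) = f 1 * f 2 * (\<Prod>i=3..t. f i)" for f :: "nat \<Rightarrow> nat"
      unfolding I by (simp add: mult.assoc)
    have "(\<Prod>i=1..t. card (F i)) >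
        ((n - 1) choose (ks 1 - 1)) * ((n - 1) choose (ks 2 - 1)) * (\<Prod>i=3..t. n choose ks i)"
      using two more t split[of "\<lambda>i. card (F i)"] by (cases "t = 2") auto
    then have "n ^ 2 * (((n - 1) choose (ks 1 - 1)) * ((n - 1) choose (ks 2 - 1)) * (\<Prod>i=3..t. n choose ks i))
        < n ^ 2 * (\<Prod>i=1..t. card (F i))"
      using npos by simp
    also have "n ^ 2 * (((n - 1) choose (ks 1 - 1)) * ((n - 1) choose (ks 2 - 1)) * (\<Prod>i=3..t. n choose ks i))
        = (n * ((n - 1) choose (ks 1 - 1))) * (n * ((n - 1) choose (ks 2 - 1))) * (\<Prod>i=3..t. n choose ks i)"
      by (simp add: power2_eq_square ac_simps)
    also have "\<dots> = ks 1 * ks 2 * (\<Prod>i=1..t. n choose ks i)"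
    proof -
      have "1 \<in> {1..t}" "2 \<in> {1..t}" using t by auto
      then show ?thesis unfolding split by (simp only: absorb ac_simps)
    qed
    finally have "real (ks 1 * ks 2 * (\<Prod>i=1..t. n choose ks i)) < real (n ^ 2 * (\<Prod>i=1..t. card (F i)))"
      by (rule of_nat_less_iff[THEN iffD2])
    moreover have "0 < (\<Prod>i=1..t. real (n choose ks i))"
      using C0 by (intro prod_pos) auto
    ultimately have prod_p: "real (ks 1 * ks 2) / real n ^ 2 < prod p {1..t}"
      using npos by (simp add: p_def prod_dividef field_simps)

    have "matched {1..t} F"
    proof (rule greedy_matching[where ks = ks])
      show "finite e \<and> card e \<le> ks i" if "i \<in> {1..t}" "e \<in> F i" for i e
        using bspec[OF F that(1)] that(2) by (auto simp: nsets_def)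
    next
      fix J assume J: "J \<subseteq> {1..t}"
      then have finJ: "finite J" using finite_subset by blast
      have prod_J: "real (ks 1 * ks 2) / real n ^ 2 < prod p J"
        using prod_p prod_subset_ge[OF _ J, of p] p01 by force
      show "matched J F \<or> (\<exists>i\<in>J. \<forall>U. finite U \<longrightarrow> card U \<le> sum ks J \<longrightarrow> (\<exists>e\<in>F i. e \<inter> U = {}))"
      proof (rule disjCI)
        assume blocked: "\<not> (\<exists>i\<in>J. \<forall>U. finite U \<longrightarrow> card U \<le> sum ks J \<longrightarrow> (\<exists>e\<in>F i. e \<inter> U = {}))"
        consider "card J = 0" | "card J = 1" | "card J = 2" | "card J \<ge> 3" by linarith
        then show "matched J F"
        proof cases
          case 1
          then show ?thesis using finJ by (simp add: matched_def disjoint_family_on_def)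
        next
          case 2
          then obtain i where i: "J = {i}" by (auto simp: card_1_singleton_iff)
          have "0 \<le> real (ks 1 * ks 2) / real n ^ 2" by simp
          also have "\<dots> < p i" using prod_J i by simp
          finally have "0 < p i" .
          then obtain e where "e \<in> F i" by (cases "F i = {}") (auto simp: p_def)
          then show ?thesis
            unfolding matched_def i by (intro exI[of _ "\<lambda>_. e"]) (auto simp: disjoint_family_on_def)
        next
          case 3
          then obtain a b where ab: "J = {a, b}" "a \<noteq> b" by (auto simp: card_2_iff)
          have a: "a \<in> {1..t}" and b: "b \<in> {1..t}" using J ab by auto
          show ?thesis
          proof (rule ccontr)
            assume not: "\<not> matched J F"
            have "X \<inter> Y \<noteq> {}" if "X \<in> F a" "Y \<in> F b" for X Y
              using not matchedI_pair[of X F a Y b] that ab by blast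
            then have "card (F a) * card (F b) \<le>
                ((card {1..n} - 1) choose (ks a - 1)) * ((card {1..n} - 1) choose (ks b - 1))"
              using a b ks0 ksk F n' by (intro cross_intersecting_card_le[where k = k]) auto
            then have "n ^ 2 * (card (F a) * card (F b)) \<le>
                n ^ 2 * (((n - 1) choose (ks a - 1)) * ((n - 1) choose (ks b - 1)))"
              by simp
            also have "\<dots> = (n * ((n - 1) choose (ks a - 1))) * (n * ((n - 1) choose (ks b - 1)))"
              by (simp add: power2_eq_square ac_simps)
            also have "\<dots> = (ks a * ks b) * ((n choose ks a) * (n choose ks b))"
              by (simp only: absorb[OF a] absorb[OF b] ac_simps)
            \<comment> \<open>Here it matters that no index in \<open>{3..t}\<close> has a larger size than \<open>ks 1\<close> or \<open>ks 2\<close>.\<close>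
            also have "\<dots> \<le> (ks 1 * ks 2) * ((n choose ks a) * (n choose ks b))"
            proof -
              have "a = 1 \<or> a = 2 \<or> a \<in> {3..t}" "b = 1 \<or> b = 2 \<or> b \<in> {3..t}"
                using a b by auto
              then have "ks a * ks b \<le> ks 1 * ks 2 \<or> ks b * ks a \<le> ks 1 * ks 2"
                using top ab(2) mult_le_mono[of "ks a" "ks 1" "ks b" "ks 2"]
                  mult_le_mono[of "ks b" "ks 1" "ks a" "ks 2"] by auto
              then show ?thesis by (simp add: mult.commute)
            qed
            finally have "real (n ^ 2 * (card (F a) * card (F b)))
                \<le> real (ks 1 * ks 2 * ((n choose ks a) * (n choose ks b)))"
              by (rule of_nat_mono)
            then have "p a * p b \<le> real (ks 1 * ks 2) / real n ^ 2"
              using C0[OF a] C0[OF b] npos by (simp add: p_def field_simps)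
            then show False using prod_J ab by simp
          qed
        next
          case 4
          have "prod p J \<le> 1 / real n ^ 2"
            unfolding p_def
          proof (rule blocked_product_le[where k = k])
            show "0 < ks i \<and> ks i \<le> k" if "i \<in> J" for i
              using that J ks0 ksk by blast
            have "sum ks J \<le> (\<Sum>i=1..t. ks i)"
              using J by (intro sum_mono2) auto
            then have "real (sum ks J) \<le> real (\<Sum>i=1..t. ks i)"
              by (rule of_nat_mono)
            then show "real (sum ks J) \<le> real n * (1 - (8 * real k * ln (real n) / real n) powr (1 / real k))"
              using sum by (rule order_trans)
            show "\<exists>U. finite U \<and> card U \<le> sum ks J \<and> (\<forall>e\<in>F i. e \<inter> U \<noteq> {})" if "i \<in> J" for i
            proof -
              have "\<not> (\<forall>U. finite U \<longrightarrow> card U \<le> sum ks J \<longrightarrow> (\<exists>e\<in>F i. e \<inter> U = {}))"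
                using blocked that by blast
              then show ?thesis by simp
            qed
          qed (use n' 4 finJ F J in blast)+
          also have "\<dots> \<le> real (ks 1 * ks 2) / real n ^ 2"
          proof (rule divide_right_mono)
            have "1 \<le> ks 1 * ks 2" using ks0 t by (simp add: Suc_le_eq)
            from of_nat_mono[where 'a = real, OF this]
            show "1 \<le> real (ks 1 * ks 2)" by (simp only: of_nat_1)
          qed simp
          finally show ?thesis using prod_J by simp
        qed
      qed
    qed simp
    then show "admits_rainbow_matching t F"
      by (simp add: admits_rainbow_matching_def rainbow_matching_def matched_def)
  qed
qed

end
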